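(* Let $n\geq 2$ be an integer. Then $$\sum_{\sigma\in D_n}(-1)^{\ell_D(\sigma)}x^{\mathrm{oDmaj}(\sigma)}y^{\mathrm{odes}_D(\sigma)}z^{\mathrm{oneg}_D(\sigma)}=\left\lfloor\tfrac n2\right\rfloor!\,(1-xz)^{\lfloor (n-1)/2\rfloor}\prod_{i=1}^{\lfloor n/2\rfloor}(1-yx^{2i}),$$ and $$\sum_{\sigma\in D_n}(-1)^{\ell_D(\sigma)}x^{\mathrm{eDmaj}(\sigma)}y^{\mathrm{edes}_D(\sigma)}z^{\mathrm{eneg}_D(\sigma)}=p_{n+1}\left\lfloor\tfrac n2\right\rfloor!\,(1+y)(1-xz)^{\lfloor (n-2)/2\rfloor}\prod_{i=1}^{\lfloor n/2\rfloor}(1-yx^{2i}).$$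
   Context: $B_n$ is the hyperoctahedral group: the group of bijections $\sigma$ of $\{-n,\dots,-1,1,\dots,n\}$ with $\sigma(-i)=-\sigma(i)$ for all $i$, written in window notation $[\sigma(1),\dots,\sigma(n)]$. For $\sigma\in B_n$ put $\sigma(0)=0$ and let $D(\sigma)=\{i\in\{0,1,\dots,n-1\}:\sigma(i)>\sigma(i+1)\}$, $\mathrm{Neg}(\sigma)=\{i\in\{1,\dots,n\}:\sigma(i)<0\}$, $\mathrm{neg}(\sigma)=|\mathrm{Neg}(\sigma)|$. $D_n=\{\sigma\in B_n:\mathrm{neg}(\sigma)\text{ is even}\}$. The Coxeter lengths are $\ell_B(\sigma)=|\{(i,j):1\le i<j\le n,\ \sigma(i)>\sigma(j)\}|-\sum_{i\in\mathrm{Neg}(\sigma)}\sigma(i)$ for $\sigma \in B_n$, and $\ell_D(\sigma)=\ell_B(\sigma)-\mathrm{neg}(\sigma)$ for $\sigma\in D_n$. For a set $J$ of integers, $J_o$ and $J_e$ denote its subsets of odd, respectively even, elements ($0$ is even). On $B_n$ define $\mathrm{odes}(\sigma)=|D(\sigma)_o|$, $\mathrm{edes}(\sigma)=|D(\sigma)_e|$, $\mathrm{omaj}(\sigma)=\sum_{i\in D(\sigma)_o}\frac{i+1}{2}$, $\mathrm{emaj}(\sigma)=\sum_{i\in D(\sigma)_e}\frac{i}{2}$, $\mathrm{oneg}(\sigma)=|\mathrm{Neg}(\sigma)_o|$, $\mathrm{eneg}(\sigma)=|\mathrm{Neg}(\sigma)_e|$, $\mathrm{ofmaj}(\sigma)=2\,\mathrm{omaj}(\sigma)+\mathrm{oneg}(\sigma)$,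 $\mathrm{efmaj}(\sigma)=2\,\mathrm{emaj}(\sigma)+\mathrm{eneg}(\sigma)$. For $\sigma\in B_n$ let $|\sigma|_n=[\sigma(1),\dots,\sigma(n-1),|\sigma(n)|]\in B_n$ and define $\mathrm{oDmaj}(\sigma)=\mathrm{ofmaj}(|\sigma|_n)$, $\mathrm{eDmaj}(\sigma)=\mathrm{efmaj}(|\sigma|_n)$, $\mathrm{odes}_D(\sigma)=\mathrm{odes}(|\sigma|_n)$, $\mathrm{edes}_D(\sigma)=\mathrm{edes}(|\sigma|_n)$, $\mathrm{oneg}_D(\sigma)=\mathrm{oneg}(|\sigma|_n)$, $\mathrm{eneg}_D(\sigma)=\mathrm{eneg}(|\sigma|_n)$ (the right-hand sides are the values at $|\sigma|_n\in B_n$ of the functions $\mathrm{ofmaj},\mathrm{efmaj},\mathrm{odes},\mathrm{edes},\mathrm{oneg},\mathrm{eneg}$ defined on $B_n$, computed from $D(|\sigma|_n)$ and $\mathrm{Neg}(|\sigma|_n)$ with the convention that the value at $0$ is $0$). For an integer $k$, $p_k=(1+(-1)^k)/2$. *)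

theory Defs
  imports Complex_Main "HOL-Combinatorics.Permutations"
begin

(* A signed permutation of {-n,...,-1,1,...,n} is a function on int that is the identity
   outside this set, so that the sets below contain one function per group element;
   in particular \<sigma> 0 = 0. *)
definition hyperoctahedral :: "nat \<Rightarrow> (int \<Rightarrow> int) set" where
  "hyperoctahedral n =
     {\<sigma>. \<sigma> permutes ({- int n..int n} - {0}) \<and>
          (\<forall>i \<in> {- int n..int n} - {0}. \<sigma> (- i) = - \<sigma> i)}"

definition descents :: "nat \<Rightarrow> (int \<Rightarrow> int) \<Rightarrow> nat set" where
  "descents n \<sigma> = {i. i < n \<and> \<sigma> (int i) > \<sigma> (int (i + 1))}"

definition Neg :: "nat \<Rightarrow> (int \<Rightarrow> int) \<Rightarrow> nat set" where
  "Neg n \<sigma> = {i. 1 \<le> i \<and> i \<le> n \<and> \<sigma> (int i) < 0}"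

definition neg :: "nat \<Rightarrow> (int \<Rightarrow> int) \<Rightarrow> nat" where
  "neg n \<sigma> = card (Neg n \<sigma>)"

definition even_hyperoctahedral :: "nat \<Rightarrow> (int \<Rightarrow> int) set" where
  "even_hyperoctahedral n = {\<sigma> \<in> hyperoctahedral n. even (neg n \<sigma>)}"

(* The argument of nat is non-negative, see int_length_B. *)
definition length_B :: "nat \<Rightarrow> (int \<Rightarrow> int) \<Rightarrow> nat" where
  "length_B n \<sigma> =
     nat (int (card {(i, j). 1 \<le> i \<and> i < j \<and> j \<le> n \<and> \<sigma> (int i) > \<sigma> (int j)})
          - (\<Sum>i\<in>Neg n \<sigma>. \<sigma> (int i)))"

(* No truncation occurs in this subtraction, see neg_le_length_B. *)
definition length_D :: "nat \<Rightarrow> (int \<Rightarrow> int) \<Rightarrow> nat" where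
  "length_D n \<sigma> = length_B n \<sigma> - neg n \<sigma>"

definition odd_part :: "nat set \<Rightarrow> nat set" where
  "odd_part J = {i \<in> J. odd i}"

definition even_part :: "nat set \<Rightarrow> nat set" where
  "even_part J = {i \<in> J. even i}"

definition odes :: "nat \<Rightarrow> (int \<Rightarrow> int) \<Rightarrow> nat" where
  "odes n \<sigma> = card (odd_part (descents n \<sigma>))"

definition edes :: "nat \<Rightarrow> (int \<Rightarrow> int) \<Rightarrow> nat" where
  "edes n \<sigma> = card (even_part (descents n \<sigma>))"

definition omaj :: "nat \<Rightarrow> (int \<Rightarrow> int) \<Rightarrow> nat" where
  "omaj n \<sigma> = (\<Sum>i\<in>odd_part (descents n \<sigma>). (i + 1) div 2)"

definition emaj :: "nat \<Rightarrow> (int \<Rightarrow> int) \<Rightarrow> nat" where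
  "emaj n \<sigma> = (\<Sum>i\<in>even_part (descents n \<sigma>). i div 2)"

definition oneg :: "nat \<Rightarrow> (int \<Rightarrow> int) \<Rightarrow> nat" where
  "oneg n \<sigma> = card (odd_part (Neg n \<sigma>))"

definition eneg :: "nat \<Rightarrow> (int \<Rightarrow> int) \<Rightarrow> nat" where
  "eneg n \<sigma> = card (even_part (Neg n \<sigma>))"

definition ofmaj :: "nat \<Rightarrow> (int \<Rightarrow> int) \<Rightarrow> nat" where
  "ofmaj n \<sigma> = 2 * omaj n \<sigma> + oneg n \<sigma>"

definition efmaj :: "nat \<Rightarrow> (int \<Rightarrow> int) \<Rightarrow> nat" where
  "efmaj n \<sigma> = 2 * emaj n \<sigma> + eneg n \<sigma>"

(* The element with window [\<sigma>(1),...,\<sigma>(n-1),|\<sigma>(n)|]; the value at -n is then forced. *)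
definition abs_last :: "nat \<Rightarrow> (int \<Rightarrow> int) \<Rightarrow> int \<Rightarrow> int" where
  "abs_last n \<sigma> = \<sigma>(int n := \<bar>\<sigma> (int n)\<bar>, - int n := - \<bar>\<sigma> (int n)\<bar>)"

definition oDmaj :: "nat \<Rightarrow> (int \<Rightarrow> int) \<Rightarrow> nat" where
  "oDmaj n \<sigma> = ofmaj n (abs_last n \<sigma>)"

definition eDmaj :: "nat \<Rightarrow> (int \<Rightarrow> int) \<Rightarrow> nat" where
  "eDmaj n \<sigma> = efmaj n (abs_last n \<sigma>)"

definition odes_D :: "nat \<Rightarrow> (int \<Rightarrow> int) \<Rightarrow> nat" where
  "odes_D n \<sigma> = odes n (abs_last n \<sigma>)"

definition edes_D :: "nat \<Rightarrow> (int \<Rightarrow> int) \<Rightarrow> nat" where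
  "edes_D n \<sigma> = edes n (abs_last n \<sigma>)"

definition oneg_D :: "nat \<Rightarrow> (int \<Rightarrow> int) \<Rightarrow> nat" where
  "oneg_D n \<sigma> = oneg n (abs_last n \<sigma>)"

definition eneg_D :: "nat \<Rightarrow> (int \<Rightarrow> int) \<Rightarrow> nat" where
  "eneg_D n \<sigma> = eneg n (abs_last n \<sigma>)"

(* For an integer k the sign (-1)^k only depends on |k|; the division by 2 is exact. *)
definition parity_ind :: "int \<Rightarrow> int" where
  "parity_ind k = (1 + (- 1) ^ nat \<bar>k\<bar>) div 2"

lemma int_length_B:
  "int (length_B n \<sigma>) =
     int (card {(i, j). 1 \<le> i \<and> i < j \<and> j \<le> n \<and> \<sigma> (int i) > \<sigma> (int j)})
     - (\<Sum>i\<in>Neg n \<sigma>. \<sigma> (int i))"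
proof -
  have "(\<Sum>i\<in>Neg n \<sigma>. \<sigma> (int i)) \<le> 0"
    by (rule sum_nonpos) (auto simp: Neg_def)
  then show ?thesis by (simp add: length_B_def)
qed

lemma neg_le_length_B: "neg n \<sigma> \<le> length_B n \<sigma>"
proof -
  have "(\<Sum>i\<in>Neg n \<sigma>. \<sigma> (int i)) \<le> (\<Sum>i\<in>Neg n \<sigma>. - 1)"
    by (rule sum_mono) (auto simp: Neg_def)
  then have "int (neg n \<sigma>) \<le> - (\<Sum>i\<in>Neg n \<sigma>. \<sigma> (int i))"
    by (simp add: neg_def)
  then show ?thesis using int_length_B[of n \<sigma>] by linarith
qed

lemma hyperoctahedral_zero: "\<sigma> \<in> hyperoctahedral n \<Longrightarrow> \<sigma> 0 = 0"
  by (simp add: hyperoctahedral_def permutes_def)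

lemma finite_hyperoctahedral: "finite (hyperoctahedral n)"
  by (rule finite_subset[OF _ finite_permutations[of "{- int n..int n} - {0}"]])
    (auto simp: hyperoctahedral_def)

lemma finite_even_hyperoctahedral: "finite (even_hyperoctahedral n)"
  by (simp add: even_hyperoctahedral_def finite_hyperoctahedral)

lemma abs_last_in_hyperoctahedral:
  assumes "\<sigma> \<in> hyperoctahedral n" "n \<ge> 1"
  shows "abs_last n \<sigma> \<in> hyperoctahedral n"
proof -
  let ?S = "{- int n..int n} - {0}"
  have perm: "\<sigma> permutes ?S" and anti: "\<And>i. i \<in> ?S \<Longrightarrow> \<sigma> (- i) = - \<sigma> i"
    using assms(1) by (auto simp: hyperoctahedral_def)
  have n: "int n \<in> ?S" "- int n \<in> ?S" using assms(2) by auto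
  have m: "\<sigma> (- int n) = - \<sigma> (int n)" using anti n by blast
  have "abs_last n \<sigma> permutes ?S"
  proof (cases "\<sigma> (int n) \<ge> 0")
    case True
    then have "abs_last n \<sigma> = \<sigma>" using m by (auto simp: abs_last_def fun_eq_iff)
    then show ?thesis using perm by simp
  next
    case False
    then have "abs_last n \<sigma> = \<sigma> \<circ> transpose (int n) (- int n)"
      using m assms(2) by (auto simp: abs_last_def fun_eq_iff transpose_def)
    then show ?thesis
      using permutes_compose[OF permutes_swap_id[OF n] perm] by simp
  qed
  moreover have "\<forall>i\<in>?S. abs_last n \<sigma> (- i) = - abs_last n \<sigma> i"
    using anti assms(2) by (auto simp: abs_last_def)
  ultimately show ?thesis by (simp add: hyperoctahedral_def)
qed

end

theory Submission
  imports Defs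
begin

text \<open>
  Write an element of \<open>B\<^sub>n\<close> as a permutation \<open>\<pi>\<close> of \<open>{1..n}\<close> together with the set \<open>N\<close> of its negative
  positions. Changing the sign of one entry changes the number of inversions plus
  \<open>\<Sum>i\<in>N. (\<pi> i - 1)\<close> by an even number, so the sign \<open>(-1)^\<ell>\<^sub>D\<close> is simply the sign of \<open>\<pi>\<close>
  (\<open>sign_length_D_signed\<close>). All other statistics read only \<open>|\<sigma>|\<^sub>n\<close>, which forgets whether \<open>n \<in> N\<close>, and
  for \<open>\<sigma> \<in> D\<^sub>n\<close> the parity of \<open>N\<close> recovers that bit. Hence both sums run over all \<open>\<pi>\<close> and
  all \<open>N \<subseteq> {1..n - 1}\<close> (\<open>sum_even_hyperoctahedral\<close>).
  
  For fixed \<open>\<pi>\<close> the weight is a product over disjoint blocks of two adjacent positions \<open>a\<close>, \<open>a + 1\<close>, where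
  \<open>a\<close> runs through the odd numbers for the first sum and through the positive even numbers for the second one. The
  \<open>k\<close>-th block contributes \<open>Y = y x^(2k)\<close> for a descent at \<open>a\<close> and \<open>X = x z\<close> for a negative
  entry at \<open>a\<close>; in the second sum position 1 contributes a further factor \<open>1 + y\<close>, because the descent at 0
  records the sign of the first entry. Summing over the signs within a block leaves an expression that depends only on the
  order of \<open>\<pi> a\<close> and \<open>\<pi> (a + 1)\<close>: it is \<open>(1 + X) (1 + Y)\<close> for an ascent of \<open>\<pi>\<close> and
  \<open>2 X + 2 Y\<close> for a descent, with difference \<open>(1 - X) (1 - Y)\<close>. If \<open>a + 1 = n\<close>, its last entry
  is positive and the values are \<open>1 + X\<close> and \<open>X + Y\<close>, with difference \<open>1 - Y\<close>.
  
  Composing \<open>\<pi>\<close> with the transposition of the two positions of a block reverses its sign, so in the alternating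
  sum over \<open>\<pi>\<close> only these differences survive (\<open>sum_sign_antisymmetrize\<close>). They multiply the signed
  number of permutations that increase on every block. That number is \<open>m!\<close> if there are \<open>m\<close> blocks and at most
  one position outside them (\<open>sum_sign_pairwise_increasing\<close>,
  \<open>sum_sign_pairwise_increasing_last_free\<close>), and 0 if two positions are outside, since these can be
  exchanged. The latter happens in the second sum when \<open>n\<close> is even.
\<close>

section \<open>Signed sums over permutations\<close>

lemma sign_comp_transpose:
  fixes \<pi> :: "nat \<Rightarrow> nat"
  assumes "\<pi> permutes S" "finite S" "a \<noteq> b"
  shows "sign (\<pi> \<circ> transpose a b) = - sign \<pi>"
proof -
  have "permutation \<pi>"
    using assms by (auto simp: permutation_permutes)
  then show ?thesis
    using assms by (simp add: sign_compose permutation_swap_id sign_swap_id)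
qed

text \<open>
  Permutations pair up under exchanging the values at \<open>a\<close> and \<open>b\<close>. The pairing is made explicit by
  splitting according to the order of these values, since \<open>S = - S\<close> would not give \<open>S = 0\<close> in
  characteristic 2.
\<close>

lemma sum_sign_swap_invariant:
  fixes R :: "(nat \<Rightarrow> nat) \<Rightarrow> 'a::comm_ring_1"
  assumes "finite S" "a \<in> S" "b \<in> S" "a \<noteq> b"
    and inv: "\<And>\<pi>. \<pi> permutes S \<Longrightarrow> R (\<pi> \<circ> transpose a b) = R \<pi>"
  shows "(\<Sum>\<pi> | \<pi> permutes S. of_int (sign \<pi>) * R \<pi>) = 0"
proof -
  let ?g = "\<lambda>\<pi>. of_int (sign \<pi>) * R \<pi>"
  let ?A = "{\<pi>. \<pi> permutes S \<and> \<pi> a < \<pi> b}" and ?B = "{\<pi>. \<pi> permutes S \<and> \<pi> b < \<pi> a}"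
  have t: "transpose a b permutes S"
    using assms by (simp add: permutes_swap_id)
  have "\<pi> a \<noteq> \<pi> b" if "\<pi> permutes S" for \<pi>
    using permutes_inj[OF that] \<open>a \<noteq> b\<close> by (auto dest: injD)
  then have split: "{\<pi>. \<pi> permutes S} = ?A \<union> ?B"
    by (auto simp: neq_iff)
  have fin: "finite {\<pi>. \<pi> permutes S}"
    using assms by (simp add: finite_permutations)
  have "sum ?g ?B = (\<Sum>\<pi>\<in>?A. ?g (\<pi> \<circ> transpose a b))"
    by (rule sum.reindex_bij_witness[of _ "\<lambda>\<pi>. \<pi> \<circ> transpose a b" "\<lambda>\<pi>. \<pi> \<circ> transpose a b"])
      (use t in \<open>auto simp: permutes_compose comp_assoc\<close>)
  also have "\<dots> = (\<Sum>\<pi>\<in>?A. - ?g \<pi>)"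
    by (rule sum.cong) (use assms in \<open>auto simp: sign_comp_transpose\<close>)
  finally have "sum ?g ?B = - sum ?g ?A"
    by (simp add: sum_negf)
  moreover have "sum ?g {\<pi>. \<pi> permutes S} = sum ?g ?A + sum ?g ?B"
    unfolding split by (rule sum.union_disjoint) (use fin in \<open>auto elim: rev_finite_subset\<close>)
  ultimately show ?thesis by simp
qed

text \<open>
  The two-valued factor of block \<open>k\<close> is \<open>B k + (A k - B k) * [ascent]\<close>. The constant part is invariant
  under exchanging the two positions of the block and so cancels. The factor \<open>R\<close> carries along the blocks that have
  already been treated.
\<close>

lemma sum_sign_antisymmetrize:
  fixes R :: "(nat \<Rightarrow> nat) \<Rightarrow> 'a::comm_ring_1" and a b :: "'k \<Rightarrow> nat" and A B :: "'k \<Rightarrow> 'a"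
  assumes "finite S" "finite K"
    and "\<And>k. k \<in> K \<Longrightarrow> a k \<in> S \<and> b k \<in> S \<and> a k \<noteq> b k"
    and "\<And>k l. k \<in> K \<Longrightarrow> l \<in> K \<Longrightarrow> k \<noteq> l \<Longrightarrow> {a k, b k} \<inter> {a l, b l} = {}"
    and "\<And>k \<pi>. k \<in> K \<Longrightarrow> \<pi> permutes S \<Longrightarrow> R (\<pi> \<circ> transpose (a k) (b k)) = R \<pi>"
  shows "(\<Sum>\<pi> | \<pi> permutes S. of_int (sign \<pi>) *
            (R \<pi> * (\<Prod>k\<in>K. if \<pi> (a k) < \<pi> (b k) then A k else B k)))
       = (\<Prod>k\<in>K. A k - B k) * (\<Sum>\<pi> | \<pi> permutes S. of_int (sign \<pi>) *
            (R \<pi> * (\<Prod>k\<in>K. of_bool (\<pi> (a k) < \<pi> (b k)))))"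
  using assms(2-)
proof (induction K arbitrary: R rule: finite_induct)
  case empty
  then show ?case by simp
next
  case (insert k K)
  let ?P = "{\<pi>. \<pi> permutes S}"
  let ?Q = "\<lambda>\<pi>. \<Prod>k\<in>K. if \<pi> (a k) < \<pi> (b k) then A k else B k"
  let ?R' = "\<lambda>\<pi>. R \<pi> * of_bool (\<pi> (a k) < \<pi> (b k))"
  have k: "a k \<in> S" "b k \<in> S" "a k \<noteq> b k"
    using insert.prems(1) by auto
  have disj: "{a k, b k} \<inter> {a l, b l} = {}" if "l \<in> K" for l
    using insert.prems(2)[of k l] insert.hyps that by auto
  have Q: "?Q (\<pi> \<circ> transpose (a k) (b k)) = ?Q \<pi>" for \<pi>
    by (rule prod.cong) (use disj in \<open>auto simp: transpose_def\<close>)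
  have zero: "(\<Sum>\<pi>\<in>?P. of_int (sign \<pi>) * (R \<pi> * ?Q \<pi>)) = 0"
    by (rule sum_sign_swap_invariant[OF assms(1) k]) (simp only: Q insert.prems(3) insertI1)
  have "(\<Sum>\<pi>\<in>?P. of_int (sign \<pi>) *
           (R \<pi> * (\<Prod>k\<in>insert k K. if \<pi> (a k) < \<pi> (b k) then A k else B k)))
      = (\<Sum>\<pi>\<in>?P. B k * (of_int (sign \<pi>) * (R \<pi> * ?Q \<pi>))
               + (A k - B k) * (of_int (sign \<pi>) * (?R' \<pi> * ?Q \<pi>)))"
    by (rule sum.cong) (use insert.hyps in \<open>auto simp: algebra_simps\<close>)
  also have "\<dots> = (A k - B k) * (\<Sum>\<pi>\<in>?P. of_int (sign \<pi>) * (?R' \<pi> * ?Q \<pi>))"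
    by (simp only: sum.distrib sum_distrib_left[symmetric] zero) simp
  also have "(\<Sum>\<pi>\<in>?P. of_int (sign \<pi>) * (?R' \<pi> * ?Q \<pi>))
      = (\<Prod>k\<in>K. A k - B k) * (\<Sum>\<pi>\<in>?P. of_int (sign \<pi>) *
            (?R' \<pi> * (\<Prod>k\<in>K. of_bool (\<pi> (a k) < \<pi> (b k)))))"
  proof (rule insert.IH)
    fix l \<pi> assume l: "l \<in> K" "\<pi> permutes S"
    then have "R (\<pi> \<circ> transpose (a l) (b l)) = R \<pi>"
      using insert.prems(3) by blast
    moreover have "transpose (a l) (b l) (a k) = a k" "transpose (a l) (b l) (b k) = b k"
      using disj[OF l(1)] by (auto simp: transpose_def)
    ultimately show "?R' (\<pi> \<circ> transpose (a l) (b l)) = ?R' \<pi>"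
      by simp
  qed (use insert.prems in auto)
  finally show ?case
    using insert.hyps by (simp add: mult_ac)
qed

section \<open>The signed number of pairwise increasing permutations\<close>

text \<open>
  The parameter \<open>c\<close> is the number of positions before the first of the \<open>m\<close> blocks. It is 0 when the blocks
  start at odd positions and 1 when they start at even positions.
\<close>

definition pairwise_increasing :: "nat \<Rightarrow> nat \<Rightarrow> nat \<Rightarrow> (nat \<Rightarrow> nat) set" where
  "pairwise_increasing n c m =
     {\<pi>. \<pi> permutes {1..n} \<and> (\<forall>k<m. \<pi> (2 * k + c + 1) < \<pi> (2 * k + c + 2))}"

lemma finite_pairwise_increasing: "finite (pairwise_increasing n c m)"
  by (rule finite_subset[OF _ finite_permutations[of "{1..n}"]]) (auto simp: pairwise_increasing_def)

text \<open>
  Exchanging the two largest values does not disturb any comparison with another value, hence is a sign-reversing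
  involution on the permutations in which these two values do not form a block.
\<close>

lemma pairwise_increasing_top_values_apart:
  assumes n: "n = 2 * m + c"
  shows "(\<Sum>\<pi> | \<pi> \<in> pairwise_increasing (n + 2) c (Suc m) \<and>
            (\<forall>k\<le>m. \<not> (\<pi> (2 * k + c + 1) = n + 1 \<and> \<pi> (2 * k + c + 2) = n + 2)). sign \<pi>) = 0"
    (is "sum sign ?E = 0")
proof -
  let ?t = "transpose (n + 1) (n + 2)"
  have t: "?t permutes {1..n + 2}"
    by (rule permutes_swap_id) auto
  have mono: "?t p < ?t q" if "p < q" "q \<le> n + 2" "\<not> (p = n + 1 \<and> q = n + 2)" for p q
    using that by (auto simp: transpose_def)
  have closed: "?t \<circ> \<pi> \<in> ?E" if \<pi>: "\<pi> \<in> ?E" for \<pi>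
  proof -
    have p: "\<pi> permutes {1..n + 2}"
      using \<pi> by (simp add: pairwise_increasing_def)
    have lt: "(?t \<circ> \<pi>) (2 * k + c + 1) < (?t \<circ> \<pi>) (2 * k + c + 2)" if "k < Suc m" for k
      unfolding comp_apply
      using \<pi> that n permutes_in_image[OF p, of "2 * k + c + 2"]
      by (intro mono) (auto simp: pairwise_increasing_def)
    have ne: "\<not> ((?t \<circ> \<pi>) (2 * k + c + 1) = n + 1 \<and> (?t \<circ> \<pi>) (2 * k + c + 2) = n + 2)"
      if "k \<le> m" for k
    proof
      assume "(?t \<circ> \<pi>) (2 * k + c + 1) = n + 1 \<and> (?t \<circ> \<pi>) (2 * k + c + 2) = n + 2"
      then have "\<pi> (2 * k + c + 1) = n + 2" "\<pi> (2 * k + c + 2) = n + 1"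
        by (auto simp: transpose_def split: if_splits)
      moreover have "\<pi> (2 * k + c + 1) < \<pi> (2 * k + c + 2)"
        using \<pi> that by (auto simp: pairwise_increasing_def)
      ultimately show False by simp
    qed
    show ?thesis
      using lt ne permutes_compose[OF p t] by (auto simp: pairwise_increasing_def)
  qed
  have "sum sign ?E = (\<Sum>\<pi>\<in>?E. sign (?t \<circ> \<pi>))"
    by (rule sum.reindex_bij_witness[of _ "\<lambda>\<pi>. ?t \<circ> \<pi>" "\<lambda>\<pi>. ?t \<circ> \<pi>"])
      (use closed in \<open>auto simp: comp_assoc[symmetric]\<close>)
  also have "\<dots> = (\<Sum>\<pi>\<in>?E. - sign \<pi>)"
  proof (rule sum.cong)
    fix \<pi> assume "\<pi> \<in> ?E"
    then have "permutation \<pi>"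
      by (auto simp: pairwise_increasing_def permutation_permutes)
    then show "sign (?t \<circ> \<pi>) = - sign \<pi>"
      by (simp add: sign_compose permutation_swap_id sign_swap_id)
  qed simp
  finally show ?thesis by (simp add: sum_negf)
qed

text \<open>
  Exchanging block \<open>k\<close> with the last block takes two transpositions, so it preserves the sign. Afterwards the
  two largest values are fixed and can be removed.
\<close>

lemma pairwise_increasing_top_block:
  assumes n: "n = 2 * m + c" and k: "k \<le> m"
  shows "(\<Sum>\<pi> | \<pi> \<in> pairwise_increasing (n + 2) c (Suc m) \<and>
            \<pi> (2 * k + c + 1) = n + 1 \<and> \<pi> (2 * k + c + 2) = n + 2. sign \<pi>)
       = sum sign (pairwise_increasing n c m)"
proof -
  let ?E = "{\<pi>. \<pi> \<in> pairwise_increasing (n + 2) c (Suc m) \<and>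
            \<pi> (2 * k + c + 1) = n + 1 \<and> \<pi> (2 * k + c + 2) = n + 2}"
  let ?s = "transpose (2 * k + c + 1) (n + 1)" and ?t = "transpose (2 * k + c + 2) (n + 2)"
  let ?r = "?s \<circ> ?t"
  have perm_r: "?r permutes {1..n + 2}"
    by (rule permutes_compose; rule permutes_swap_id) (use n k in auto)
  \<comment> \<open>The permutation \<open>?r\<close> of the positions moves whole blocks: it acts on their
    indices as the transposition of \<open>k\<close> and \<open>m\<close>.\<close>
  have r1: "?r (2 * l + c + 1) = 2 * (transpose k m l) + c + 1"
    and r2: "?r (2 * l + c + 2) = 2 * (transpose k m l) + c + 2" for l
    unfolding n
    by (auto simp: transpose_def Suc_double_not_eq_double double_not_eq_Suc_double)
  have rr: "?r \<circ> ?r = id"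
  proof
    fix i
    show "(?r \<circ> ?r) i = id i"
      unfolding n
      by (auto simp: transpose_def Suc_double_not_eq_double double_not_eq_Suc_double)
  qed
  have sign_r: "sign ?r = 1"
    by (simp add: sign_compose permutation_swap_id sign_swap_id n)
  have tr: "transpose k m l < Suc m" if "l < Suc m" for l
    using that k by (auto simp: transpose_def)
  have fixed: "pairwise_increasing n c m = {\<pi> \<in> pairwise_increasing (n + 2) c (Suc m).
      \<pi> (n + 1) = n + 1 \<and> \<pi> (n + 2) = n + 2}" (is "_ = ?F")
  proof (intro equalityI subsetI)
    fix \<pi> assume \<pi>: "\<pi> \<in> pairwise_increasing n c m"
    then have "\<pi> permutes {1..n}"
      by (simp add: pairwise_increasing_def)
    then have "\<pi> permutes {1..n + 2}" "\<pi> (n + 1) = n + 1" "\<pi> (n + 2) = n + 2"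
      by (auto intro: permutes_subset simp: permutes_def)
    then show "\<pi> \<in> ?F"
      using \<pi> by (auto simp: pairwise_increasing_def less_Suc_eq n)
  next
    fix \<pi> assume \<pi>: "\<pi> \<in> ?F"
    have "\<pi> permutes {1..n}"
      by (rule permutes_superset[of _ "{1..n + 2}"])
        (use \<pi> in \<open>auto simp: pairwise_increasing_def atLeastAtMost_def atMost_def le_Suc_eq\<close>)
    then show "\<pi> \<in> pairwise_increasing n c m"
      using \<pi> by (auto simp: pairwise_increasing_def)
  qed
  have E_F: "\<pi> \<circ> ?r \<in> ?F" if "\<pi> \<in> ?E" for \<pi>
  proof -
    have "(\<pi> \<circ> ?r) (2 * l + c + 1) < (\<pi> \<circ> ?r) (2 * l + c + 2)" if "l < Suc m" for l
      using \<open>\<pi> \<in> ?E\<close> tr[OF that] by (simp only: comp_apply r1[unfolded comp_apply] r2[unfolded comp_apply])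
        (simp add: pairwise_increasing_def)
    moreover have "(\<pi> \<circ> ?r) (n + 1) = n + 1" "(\<pi> \<circ> ?r) (n + 2) = n + 2"
      using \<open>\<pi> \<in> ?E\<close> r1[of m] r2[of m] by (simp_all add: n)
    ultimately show ?thesis
      using that permutes_compose[OF perm_r, of \<pi>] by (auto simp: pairwise_increasing_def)
  qed
  have F_E: "\<pi> \<circ> ?r \<in> ?E" if "\<pi> \<in> ?F" for \<pi>
  proof -
    have "(\<pi> \<circ> ?r) (2 * l + c + 1) < (\<pi> \<circ> ?r) (2 * l + c + 2)" if "l < Suc m" for l
      using \<open>\<pi> \<in> ?F\<close> tr[OF that] by (simp only: comp_apply r1[unfolded comp_apply] r2[unfolded comp_apply])
        (simp add: pairwise_increasing_def)
    moreover have "(\<pi> \<circ> ?r) (2 * k + c + 1) = n + 1" "(\<pi> \<circ> ?r) (2 * k + c + 2) = n + 2"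
      using \<open>\<pi> \<in> ?F\<close> r1[of k] r2[of k] by (simp_all add: n)
    ultimately show ?thesis
      using that permutes_compose[OF perm_r, of \<pi>] by (auto simp: pairwise_increasing_def)
  qed
  have "sum sign ?E = sum sign ?F"
  proof (rule sum.reindex_bij_witness[of _ "\<lambda>\<pi>. \<pi> \<circ> ?r" "\<lambda>\<pi>. \<pi> \<circ> ?r"])
    fix \<pi> assume "\<pi> \<in> ?E"
    then have "permutation \<pi>"
      by (auto simp: pairwise_increasing_def permutation_permutes)
    moreover have "permutation ?r"
      using perm_r by (auto simp: permutation_permutes)
    ultimately have "sign (\<pi> \<circ> ?r) = sign \<pi> * sign ?r"
      by (rule sign_compose)
    then show "sign (\<pi> \<circ> ?r) = sign \<pi>"
      by (simp only: sign_r mult_1_right)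
  qed (use E_F F_E rr in \<open>simp_all only: comp_assoc comp_id\<close>)
  then show ?thesis
    by (simp only: fixed)
qed

text \<open>
  Only permutations whose two largest values share a block survive cancellation, and by symmetry each of the
  \<open>m + 1\<close> blocks can be the one that holds them; this gives the recursion of the factorial. A position
  outside the blocks precedes all of them, so it survives until the base case.
\<close>

lemma sum_sign_pairwise_increasing:
  assumes "c \<le> 1"
  shows "sum sign (pairwise_increasing (2 * m + c) c m) = fact m"
proof (induction m)
  case 0
  have "{\<pi>. \<pi> permutes {1..c}} = {id}"
    using assms by (cases "c = 0") (auto simp: le_Suc_eq)
  then show ?case by (simp add: pairwise_increasing_def)
next
  case (Suc m)
  define n where "n = 2 * m + c"
  let ?O = "pairwise_increasing (n + 2) c (Suc m)"
  let ?T = "\<lambda>k. {\<pi> \<in> ?O. \<pi> (2 * k + c + 1) = n + 1 \<and> \<pi> (2 * k + c + 2) = n + 2}"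
  let ?E = "{\<pi> \<in> ?O. \<forall>k\<le>m. \<not> (\<pi> (2 * k + c + 1) = n + 1 \<and> \<pi> (2 * k + c + 2) = n + 2)}"
  have fin: "finite ?O" by (rule finite_pairwise_increasing)
  have disj: "?T k \<inter> ?T l = {}" if "k \<noteq> l" for k l
  proof -
    have False if "\<pi> \<in> ?T k" "\<pi> \<in> ?T l" for \<pi>
    proof -
      have "\<pi> permutes {1..n + 2}" using that by (simp add: pairwise_increasing_def)
      then have "inj \<pi>" by (rule permutes_inj)
      then show False
        using that \<open>k \<noteq> l\<close> injD[of \<pi> "2 * k + c + 1" "2 * l + c + 1"] by auto
    qed
    then show ?thesis by blast
  qed
  have "sum sign ?O = sum sign (?E \<union> (\<Union>k\<le>m. ?T k))"
    by (rule sum.cong) auto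
  also have "\<dots> = sum sign ?E + sum sign (\<Union>k\<le>m. ?T k)"
    by (rule sum.union_disjoint) (use fin in auto)
  also have "sum sign ?E = 0"
    using pairwise_increasing_top_values_apart[OF n_def] by simp
  also have "sum sign (\<Union>k\<le>m. ?T k) = (\<Sum>k\<le>m. sum sign (?T k))"
    by (rule sum.UNION_disjoint) (use fin disj in auto)
  also have "\<dots> = (\<Sum>k\<le>m. fact m)"
    by (rule sum.cong) (use pairwise_increasing_top_block[OF n_def] Suc.IH in \<open>auto simp: n_def\<close>)
  finally show ?case by (simp add: n_def)
qed

text \<open>
  Conjugation with the order-reversing permutation \<open>w\<close> preserves the sign and moves the free position from the
  last place to the first one.
\<close>

lemma sum_sign_pairwise_increasing_last_free:
  "sum sign (pairwise_increasing (2 * m + 1) 0 m) = fact m"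
proof -
  define n where "n = 2 * m + 1"
  define w where "w i = (if i \<in> {1..n} then n + 1 - i else i)" for i :: nat
  have ww: "w (w i) = i" for i by (auto simp: w_def)
  have perm_w: "w permutes {1..n}"
    by (rule bij_imp_permutes, rule bij_betw_byWitness[where f' = w]) (auto simp: w_def)
  have w_in: "w i \<in> {1..n}" if "i \<in> {1..n}" for i
    using that by (auto simp: w_def)
  have w_less: "w i < w j" if "i \<in> {1..n}" "j \<in> {1..n}" "j < i" for i j
    using that by (auto simp: w_def)
  have pw: "permutation w" using perm_w by (auto simp: permutation_permutes)
  have conj: "w \<circ> \<pi> \<circ> w \<in> pairwise_increasing n (1 - c) m"
    if \<pi>: "\<pi> \<in> pairwise_increasing n c m" and c: "c \<le> 1" for \<pi> c
  proof -
    have p: "\<pi> permutes {1..n}" using \<pi> by (simp add: pairwise_increasing_def)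
    have "w \<circ> \<pi> \<circ> w permutes {1..n}"
      using p perm_w by (intro permutes_compose)
    moreover have "w (\<pi> (w (2 * k + (1 - c) + 1))) < w (\<pi> (w (2 * k + (1 - c) + 2)))"
      if k: "k < m" for k
    proof (rule w_less)
      let ?l = "m - 1 - k"
      have "w (2 * k + (1 - c) + 1) = 2 * ?l + c + 2" "w (2 * k + (1 - c) + 2) = 2 * ?l + c + 1"
        using k c by (auto simp: w_def n_def)
      moreover have "\<pi> (2 * ?l + c + 1) < \<pi> (2 * ?l + c + 2)"
        using \<pi> k by (auto simp: pairwise_increasing_def)
      ultimately show "\<pi> (w (2 * k + (1 - c) + 2)) < \<pi> (w (2 * k + (1 - c) + 1))"
        by simp
      show "\<pi> (w (2 * k + (1 - c) + 1)) \<in> {1..n}" "\<pi> (w (2 * k + (1 - c) + 2)) \<in> {1..n}"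
        unfolding permutes_in_image[OF p] by (rule w_in; use k c in \<open>simp add: n_def\<close>)+
    qed
    ultimately show ?thesis by (simp add: pairwise_increasing_def)
  qed
  have "sum sign (pairwise_increasing n 0 m) = sum sign (pairwise_increasing n 1 m)"
  proof (rule sum.reindex_bij_witness[of _ "\<lambda>\<pi>. w \<circ> \<pi> \<circ> w" "\<lambda>\<pi>. w \<circ> \<pi> \<circ> w"])
    fix \<pi> assume "\<pi> \<in> pairwise_increasing n 0 m"
    then have "permutation \<pi>"
      by (auto simp: pairwise_increasing_def permutation_permutes)
    then show "sign (w \<circ> \<pi> \<circ> w) = sign \<pi>"
      using pw by (simp add: sign_compose permutation_compose)
  qed (use conj[of _ 0] conj[of _ 1] in \<open>auto simp: fun_eq_iff ww\<close>)
  then show ?thesis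
    using sum_sign_pairwise_increasing[of 1 m] by (simp add: n_def)
qed

section \<open>Sign and inversions\<close>

definition inversions :: "nat \<Rightarrow> (nat \<Rightarrow> 'a::linorder) \<Rightarrow> (nat \<times> nat) set" where
  "inversions n f = {(i, j). 1 \<le> i \<and> i < j \<and> j \<le> n \<and> f i > f j}"

lemma finite_inversions: "finite (inversions n f)"
  by (rule finite_subset[of _ "{1..n} \<times> {1..n}"]) (auto simp: inversions_def)

lemma permutes_without_descents:
  fixes \<pi> :: "nat \<Rightarrow> nat"
  assumes "\<pi> permutes {1..n}" and "\<And>a. 1 \<le> a \<Longrightarrow> a < n \<Longrightarrow> \<pi> a \<le> \<pi> (Suc a)"
  shows "\<pi> = id"
proof (rule permutes_natset_ge[OF assms(1)])
  have "i \<le> n \<longrightarrow> i \<le> \<pi> i" for i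
  proof (induction i)
    case (Suc i)
    show ?case
    proof
      assume i: "Suc i \<le> n"
      show "Suc i \<le> \<pi> (Suc i)"
      proof (cases "i = 0")
        case True
        then show ?thesis
          using permutes_in_image[OF assms(1), of 1] i by simp
      next
        case False
        have "\<pi> i \<noteq> \<pi> (Suc i)"
          using inj_eq[OF permutes_inj[OF assms(1)]] by simp
        moreover have "\<pi> i \<le> \<pi> (Suc i)"
          using assms(2) i False by simp
        ultimately show ?thesis
          using Suc.IH i by linarith
      qed
    qed
  qed simp
  then show "\<forall>i\<in>{1..n}. i \<le> \<pi> i" by auto
qed

text \<open>
  Sorting by adjacent transpositions: each one applied at a descent removes exactly one inversion and changes the sign.
\<close>

lemma sign_eq_inversions:
  assumes "\<pi> permutes {1..n}"
  shows "sign \<pi> = (- 1) ^ card (inversions n \<pi>)"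
  using assms
proof (induction "card (inversions n \<pi>)" arbitrary: \<pi> rule: less_induct)
  case less
  show ?case
  proof (cases "\<exists>a. 1 \<le> a \<and> a < n \<and> \<pi> (Suc a) < \<pi> a")
    case False
    then have "\<pi> = id"
      using less.prems by (intro permutes_without_descents[of \<pi> n]) (auto simp: not_less)
    then have "inversions n \<pi> = {}"
      by (auto simp: inversions_def)
    then show ?thesis
      using \<open>\<pi> = id\<close> by simp
  next
    case True
    then obtain a where a: "1 \<le> a" "a < n" "\<pi> (Suc a) < \<pi> a" by blast
    let ?t = "transpose a (Suc a)"
    let ?\<rho> = "\<pi> \<circ> ?t"
    have perm: "?\<rho> permutes {1..n}"
      using a less.prems by (intro permutes_compose permutes_swap_id) auto
    have "bij_betw (map_prod ?t ?t) (inversions n ?\<rho>) (inversions n \<pi> - {(a, Suc a)})"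
    proof (rule bij_betw_byWitness[where f' = "map_prod ?t ?t"])
      show "map_prod ?t ?t ` inversions n ?\<rho> \<subseteq> inversions n \<pi> - {(a, Suc a)}"
        using a by (auto simp: inversions_def transpose_def split: if_splits)
      show "map_prod ?t ?t ` (inversions n \<pi> - {(a, Suc a)}) \<subseteq> inversions n ?\<rho>"
        using a by (auto simp: inversions_def transpose_def split: if_splits)
    qed auto
    then have "card (inversions n ?\<rho>) = card (inversions n \<pi> - {(a, Suc a)})"
      by (rule bij_betw_same_card)
    moreover have "(a, Suc a) \<in> inversions n \<pi>"
      using a by (auto simp: inversions_def)
    ultimately have card: "card (inversions n \<pi>) = Suc (card (inversions n ?\<rho>))"
      using card.remove[OF finite_inversions] by metis
    have "sign ?\<rho> = (- 1) ^ card (inversions n ?\<rho>)"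
      using less.hyps[OF _ perm] card by simp
    moreover have "sign ?\<rho> = - sign \<pi>"
      using less.prems by (rule sign_comp_transpose) auto
    ultimately show ?thesis
      by (simp add: card)
  qed
qed

section \<open>Signed permutations as permutations with a set of negative positions\<close>

text \<open>
  The formula is meant for \<open>\<pi>\<close> permuting \<open>{1..n}\<close> and \<open>N \<subseteq> {1..n}\<close>. It then also
  yields the identity outside \<open>{-n..n} - {0}\<close>, without a case distinction.
\<close>

definition signed :: "(nat \<Rightarrow> nat) \<Rightarrow> nat set \<Rightarrow> int \<Rightarrow> int" where
  "signed \<pi> N i = sgn i * (if nat \<bar>i\<bar> \<in> N then - 1 else 1) * int (\<pi> (nat \<bar>i\<bar>))"

definition underlying :: "(int \<Rightarrow> int) \<Rightarrow> nat \<Rightarrow> nat" where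
  "underlying \<sigma> i = nat \<bar>\<sigma> (int i)\<bar>"

lemma permutes_pos_iff:
  fixes \<pi> :: "nat \<Rightarrow> nat"
  assumes "\<pi> permutes {1..n}"
  shows "\<pi> i > 0 \<longleftrightarrow> i > 0"
  using permutes_in_image[OF assms, of i] permutes_not_in[OF assms, of i] by (cases "i \<in> {1..n}") auto

lemma signed_of_nat:
  assumes "\<pi> permutes {1..n}"
  shows "signed \<pi> N (int i) = (if i \<in> N then - int (\<pi> i) else int (\<pi> i))"
  using permutes_pos_iff[OF assms, of i] by (cases "i = 0") (auto simp: signed_def)

lemma signed_in_hyperoctahedral:
  assumes \<pi>: "\<pi> permutes {1..n}" and N: "N \<subseteq> {1..n}"
  shows "signed \<pi> N \<in> hyperoctahedral n"
proof -
  let ?S = "{- int n..int n} - {0}"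
  have abs: "\<bar>signed \<pi> N i\<bar> = int (\<pi> (nat \<bar>i\<bar>))" if "i \<noteq> 0" for i
    using that by (simp add: signed_def abs_mult)
  have "signed \<pi> N ` ?S \<subseteq> ?S"
  proof
    fix v assume "v \<in> signed \<pi> N ` ?S"
    then obtain i where i: "i \<in> ?S" "v = signed \<pi> N i" by blast
    then have "nat \<bar>i\<bar> \<in> {1..n}" by auto
    then have "\<pi> (nat \<bar>i\<bar>) \<in> {1..n}"
      using permutes_in_image[OF \<pi>] by blast
    then show "v \<in> ?S" using abs[of i] i by auto
  qed
  moreover have inj: "inj_on (signed \<pi> N) ?S"
  proof (rule inj_onI)
    fix i j assume ij: "i \<in> ?S" "j \<in> ?S" "signed \<pi> N i = signed \<pi> N j"
    then have "\<pi> (nat \<bar>i\<bar>) = \<pi> (nat \<bar>j\<bar>)"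
      using abs[of i] abs[of j] by simp
    then have eq: "nat \<bar>i\<bar> = nat \<bar>j\<bar>"
      using permutes_inj[OF \<pi>] by (simp add: inj_eq)
    have "\<pi> (nat \<bar>j\<bar>) > 0"
      using permutes_pos_iff[OF \<pi>] ij by auto
    then have "sgn i = sgn j"
      using ij(3) by (auto simp: signed_def eq split: if_splits)
    then show "i = j"
      using eq by (metis nat_0_le abs_ge_zero mult_sgn_abs)
  qed
  ultimately have "bij_betw (signed \<pi> N) ?S ?S"
    by (simp add: bij_betw_def endo_inj_surj)
  moreover have "signed \<pi> N i = i" if "i \<notin> ?S" for i
  proof (cases "i = 0")
    case False
    then have "nat \<bar>i\<bar> \<notin> {1..n}" using that by auto
    then show ?thesis
      using permutes_not_in[OF \<pi>] N by (auto simp: signed_def sgn_mult_abs)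
  qed (simp add: signed_def)
  ultimately have "signed \<pi> N permutes ?S"
    by (rule bij_imp_permutes)
  then show ?thesis
    by (auto simp: hyperoctahedral_def signed_def sgn_if)
qed

lemma underlying_signed:
  assumes "\<pi> permutes {1..n}"
  shows "underlying (signed \<pi> N) = \<pi>"
  by (rule ext) (simp add: underlying_def signed_of_nat[OF assms])

lemma Neg_signed:
  assumes \<pi>: "\<pi> permutes {1..n}" and N: "N \<subseteq> {1..n}"
  shows "Neg n (signed \<pi> N) = N"
  unfolding Neg_def signed_of_nat[OF \<pi>] using N permutes_pos_iff[OF \<pi>] by (auto simp: Suc_le_eq)

lemma underlying_permutes:
  assumes "\<sigma> \<in> hyperoctahedral n"
  shows "underlying \<sigma> permutes {1..n}"
proof -
  let ?S = "{- int n..int n} - {0}"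
  have \<sigma>: "\<sigma> permutes ?S" and odd: "\<And>i. i \<in> ?S \<Longrightarrow> \<sigma> (- i) = - \<sigma> i"
    using assms by (auto simp: hyperoctahedral_def)
  have "underlying \<sigma> ` {1..n} \<subseteq> {1..n}"
  proof
    fix v assume "v \<in> underlying \<sigma> ` {1..n}"
    then obtain i where i: "i \<in> {1..n}" "v = nat \<bar>\<sigma> (int i)\<bar>"
      by (auto simp: underlying_def)
    then have "\<sigma> (int i) \<in> ?S"
      by (simp only: permutes_in_image[OF \<sigma>]) auto
    then show "v \<in> {1..n}"
      using i by auto
  qed
  moreover have "inj_on (underlying \<sigma>) {1..n}"
  proof (rule inj_onI)
    fix i j assume ij: "i \<in> {1..n}" "j \<in> {1..n}" "underlying \<sigma> i = underlying \<sigma> j"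
    then have "\<sigma> (int i) = \<sigma> (int j) \<or> \<sigma> (int i) = \<sigma> (- int j)"
      using odd[of "int j"] by (auto simp: underlying_def abs_if split: if_splits)
    then have "int i = int j \<or> int i = - int j"
      using permutes_inj[OF \<sigma>] by (simp add: inj_eq)
    then show "i = j" using ij by auto
  qed
  ultimately have "bij_betw (underlying \<sigma>) {1..n} {1..n}"
    by (simp add: bij_betw_def endo_inj_surj)
  moreover have "underlying \<sigma> i = i" if "i \<notin> {1..n}" for i
    using that permutes_not_in[OF \<sigma>, of "int i"] by (auto simp: underlying_def)
  ultimately show ?thesis
    by (rule bij_imp_permutes)
qed

lemma signed_underlying:
  assumes "\<sigma> \<in> hyperoctahedral n"
  shows "signed (underlying \<sigma>) (Neg n \<sigma>) = \<sigma>"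
proof
  fix i
  let ?S = "{- int n..int n} - {0}"
  have \<sigma>: "\<sigma> permutes ?S" and odd: "\<And>i. i \<in> ?S \<Longrightarrow> \<sigma> (- i) = - \<sigma> i"
    using assms by (auto simp: hyperoctahedral_def)
  show "signed (underlying \<sigma>) (Neg n \<sigma>) i = \<sigma> i"
  proof (cases "i \<in> ?S")
    case True
    then show ?thesis
      using odd[of i] by (cases "i > 0") (auto simp: signed_def underlying_def Neg_def)
  next
    case False
    then have "\<sigma> i = i" "\<sigma> \<bar>i\<bar> = \<bar>i\<bar>"
      using permutes_not_in[OF \<sigma>] by auto
    then show ?thesis
      using False by (auto simp: signed_def underlying_def Neg_def sgn_mult_abs)
  qed
qed

lemma abs_last_signed:
  assumes \<pi>: "\<pi> permutes {1..n}" and n: "n \<ge> 1"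
  shows "abs_last n (signed \<pi> N) = signed \<pi> (N - {n})"
proof
  fix i
  consider "i = int n" | "i = - int n" | "nat \<bar>i\<bar> \<noteq> n" by linarith
  then show "abs_last n (signed \<pi> N) i = signed \<pi> (N - {n}) i"
    by cases (use n in \<open>auto simp: abs_last_def signed_def\<close>)
qed

lemma card_values_below:
  fixes \<pi> :: "nat \<Rightarrow> nat"
  assumes \<pi>: "\<pi> permutes {1..n}" and i: "i \<in> {1..n}"
  shows "card {j \<in> {1..n}. \<pi> j < \<pi> i} = \<pi> i - 1"
proof -
  have "\<pi> ` {j \<in> {1..n}. \<pi> j < \<pi> i} = {v \<in> \<pi> ` {1..n}. v < \<pi> i}"
    by blast
  also have "\<dots> = {1..<\<pi> i}"
    using permutes_image[OF \<pi>] permutes_in_image[OF \<pi>, of i] i by auto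
  finally have "card {1..<\<pi> i} = card {j \<in> {1..n}. \<pi> j < \<pi> i}"
    using card_image[OF inj_on_subset[OF permutes_inj[OF \<pi>] subset_UNIV]] by metis
  then show ?thesis by simp
qed

text \<open>
  Giving entries signs changes the order of the positions \<open>i < j\<close> exactly when the entry of larger absolute value
  becomes negative. The set \<open>L\<close> of these pairs is therefore the symmetric difference of the two inversion sets.
  Counting it by the position of the larger entry shows \<open>|L| = (\<Sum>i\<in>N. \<pi> i - 1)\<close>.
\<close>

lemma card_inversions_signed:
  assumes \<pi>: "\<pi> permutes {1..n}" and N: "N \<subseteq> {1..n}"
  shows "even (card (inversions n (\<lambda>i. signed \<pi> N (int i))) + (\<Sum>i\<in>N. \<pi> i - 1)
           + card (inversions n \<pi>))"
proof -
  let ?I = "inversions n (\<lambda>i. signed \<pi> N (int i))" and ?J = "inversions n \<pi>"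
  define L where "L = {(i, j). 1 \<le> i \<and> i < j \<and> j \<le> n \<and> (if \<pi> j < \<pi> i then i else j) \<in> N}"
  have finL: "finite L"
    by (rule finite_subset[of _ "{1..n} \<times> {1..n}"]) (auto simp: L_def)
  have finN: "finite N" using N finite_subset by blast
  have ne: "\<pi> i \<noteq> \<pi> j" if "i < j" for i j
    using that inj_eq[OF permutes_inj[OF \<pi>]] by simp
  have sym: "?I = (?J - L) \<union> (L - ?J)"
  proof (rule set_eqI, clarify)
    fix i j
    show "((i, j) \<in> ?I) = ((i, j) \<in> ?J - L \<union> (L - ?J))"
      using permutes_pos_iff[OF \<pi>, of i] permutes_pos_iff[OF \<pi>, of j] ne[of i j]
      by (auto simp: inversions_def signed_of_nat[OF \<pi>] L_def)
  qed
  have "card ?I = card (?J - L) + card (L - ?J)"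
    unfolding sym by (rule card_Un_disjoint) (use finL finite_inversions in auto)
  moreover have "card ?J = card (?J - L) + card (?J \<inter> L)"
    using card_Diff_subset_Int[of ?J L] card_mono[OF finite_inversions[of n \<pi>], of "?J \<inter> L"] finL by auto
  moreover have "card L = card (L - ?J) + card (?J \<inter> L)"
    using card_Diff_subset_Int[of L ?J] card_mono[OF finL, of "?J \<inter> L"] finL by (auto simp: Int_commute)
  moreover have "card L = (\<Sum>i\<in>N. \<pi> i - 1)"
  proof -
    let ?f = "\<lambda>(i, j). if \<pi> j < \<pi> i then (i, j) else (j, i)"
    let ?g = "\<lambda>(i, j). if i < j then (i, j) else (j, i :: nat)"
    have "bij_betw ?f L (SIGMA i:N. {j \<in> {1..n}. \<pi> j < \<pi> i})"
    proof (rule bij_betw_byWitness[where f' = ?g])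
      have L: "1 \<le> i" "i < j" "j \<le> n" "(if \<pi> j < \<pi> i then i else j) \<in> N" "\<pi> i \<noteq> \<pi> j"
        if "(i, j) \<in> L" for i j
        using that ne[of i j] by (auto simp: L_def)
      have R: "i \<in> N" "i \<noteq> j" "1 \<le> i" "i \<le> n" "1 \<le> j" "j \<le> n" "\<pi> j < \<pi> i"
        if "(i, j) \<in> (SIGMA i:N. {j \<in> {1..n}. \<pi> j < \<pi> i})" for i j
        using that N by auto
      show "\<forall>p\<in>L. ?g (?f p) = p"
      proof
        fix p assume "p \<in> L"
        then show "?g (?f p) = p"
          using L(2)[of "fst p" "snd p"] by (cases p) simp
      qed
      show "\<forall>p\<in>SIGMA i:N. {j \<in> {1..n}. \<pi> j < \<pi> i}. ?f (?g p) = p"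
        using R(2) by (auto simp: not_less le_less)
      show "?f ` L \<subseteq> (SIGMA i:N. {j \<in> {1..n}. \<pi> j < \<pi> i})"
      proof (rule image_subsetI)
        fix p assume "p \<in> L"
        then show "?f p \<in> (SIGMA i:N. {j \<in> {1..n}. \<pi> j < \<pi> i})"
          using L[of "fst p" "snd p"] by (cases p; cases "\<pi> (snd p) < \<pi> (fst p)") simp_all
      qed
      show "?g ` (SIGMA i:N. {j \<in> {1..n}. \<pi> j < \<pi> i}) \<subseteq> L"
      proof (rule image_subsetI)
        fix p assume "p \<in> (SIGMA i:N. {j \<in> {1..n}. \<pi> j < \<pi> i})"
        then show "?g p \<in> L"
          using R[of "fst p" "snd p"] by (cases p; cases "fst p < snd p") (simp_all add: L_def)
      qed
    qed
    then have "card L = card (SIGMA i:N. {j \<in> {1..n}. \<pi> j < \<pi> i})"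
      by (rule bij_betw_same_card)
    also have "\<dots> = (\<Sum>i\<in>N. card {j \<in> {1..n}. \<pi> j < \<pi> i})"
      by (rule card_SigmaI) (use finN in auto)
    also have "\<dots> = (\<Sum>i\<in>N. \<pi> i - 1)"
      by (rule sum.cong) (use N card_values_below[OF \<pi>] in auto)
    finally show ?thesis .
  qed
  ultimately have "card ?I + (\<Sum>i\<in>N. \<pi> i - 1) + card ?J
      = 2 * (card (?J - L) + card (L - ?J) + card (?J \<inter> L))"
    by simp
  then show ?thesis by simp
qed

text \<open>
  The difference \<open>\<ell>\<^sub>B - neg\<close> is the number of inversions plus \<open>\<Sum>i\<in>N. (\<pi> i - 1)\<close>, so
  the parity count above identifies the sign.
\<close>

lemma sign_length_D_signed:
  assumes \<pi>: "\<pi> permutes {1..n}" and N: "N \<subseteq> {1..n}"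
  shows "(- 1) ^ length_D n (signed \<pi> N) = (of_int (sign \<pi>) :: 'a::comm_ring_1)"
proof -
  let ?I = "inversions n (\<lambda>i. signed \<pi> N (int i))"
  have finN: "finite N" using N finite_subset by blast
  have pos: "\<pi> i \<ge> 1" if "i \<in> N" for i
    using that N permutes_pos_iff[OF \<pi>, of i] by force
  have "int (length_D n (signed \<pi> N)) = int (card ?I) - (\<Sum>i\<in>N. signed \<pi> N (int i)) - int (card N)"
    using int_length_B[of n "signed \<pi> N"] neg_le_length_B[of n "signed \<pi> N"]
    by (simp add: length_D_def neg_def Neg_signed[OF \<pi> N] inversions_def of_nat_diff)
  also have "(\<Sum>i\<in>N. signed \<pi> N (int i)) = - (\<Sum>i\<in>N. int (\<pi> i - 1)) - int (card N)"
  proof -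
    have "(\<Sum>i\<in>N. signed \<pi> N (int i)) = (\<Sum>i\<in>N. - int (\<pi> i - 1) - 1)"
      by (rule sum.cong) (use pos in \<open>auto simp: signed_of_nat[OF \<pi>] of_nat_diff\<close>)
    then show ?thesis by (simp add: sum_subtractf sum_negf)
  qed
  finally have "length_D n (signed \<pi> N) = card ?I + (\<Sum>i\<in>N. \<pi> i - 1)"
    by (simp flip: of_nat_sum of_nat_add)
  then have "even (length_D n (signed \<pi> N) + card (inversions n \<pi>))"
    using card_inversions_signed[OF \<pi> N] by simp
  then have "even (length_D n (signed \<pi> N)) = even (card (inversions n \<pi>))"
    by simp
  then show ?thesis
    by (simp add: sign_eq_inversions[OF \<pi>] minus_one_power_iff)
qed

text \<open>
  Passing to \<open>|\<sigma>|\<^sub>n\<close> removes \<open>n\<close> from the set of negative positions. On \<open>D\<^sub>n\<close> this loses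
  nothing, because whether \<open>n\<close> was present is determined by the parity of the remaining set.
\<close>

lemma sum_even_hyperoctahedral:
  fixes f :: "(int \<Rightarrow> int) \<Rightarrow> 'a::comm_ring_1"
  assumes n: "n \<ge> 1"
  shows "(\<Sum>\<sigma>\<in>even_hyperoctahedral n. (- 1) ^ length_D n \<sigma> * f (abs_last n \<sigma>))
       = (\<Sum>\<pi> | \<pi> permutes {1..n}. of_int (sign \<pi>) * (\<Sum>N\<in>Pow {1..n - 1}. f (signed \<pi> N)))"
proof -
  let ?P = "{\<pi>. \<pi> permutes {1..n}}"
  let ?N = "\<lambda>N. if even (card N) then N else insert n N"
  have N: "?N M \<subseteq> {1..n}" "even (card (?N M))" "?N M - {n} = M"
    if "M \<subseteq> {1..n - 1}" for M
  proof -
    have "n \<notin> M" "finite M" using that n finite_subset by auto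
    moreover have "M \<subseteq> {1..n}" using that by force
    ultimately show "?N M \<subseteq> {1..n}" "even (card (?N M))" "?N M - {n} = M"
      using n by auto
  qed
  have N': "?N (M - {n}) = M" if "M \<subseteq> {1..n}" "even (card M)" for M
  proof (cases "n \<in> M")
    case True
    have "finite M" using that finite_subset by blast
    then have "card M = Suc (card (M - {n}))"
      using True by (rule card.remove)
    then have "odd (card (M - {n}))"
      using that(2) by simp
    then show ?thesis
      using True by auto
  qed (use that in simp)
  have "(\<Sum>\<sigma>\<in>even_hyperoctahedral n. (- 1) ^ length_D n \<sigma> * f (abs_last n \<sigma>))
      = (\<Sum>(\<pi>, M)\<in>?P \<times> Pow {1..n - 1}. of_int (sign \<pi>) * f (signed \<pi> M))"
  proof (rule sum.reindex_bij_witness[of _ "\<lambda>(\<pi>, M). signed \<pi> (?N M)"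
        "\<lambda>\<sigma>. (underlying \<sigma>, Neg n \<sigma> - {n})"])
    fix \<sigma> assume "\<sigma> \<in> even_hyperoctahedral n"
    then have \<sigma>: "\<sigma> \<in> hyperoctahedral n" "even (card (Neg n \<sigma>))"
      by (auto simp: even_hyperoctahedral_def neg_def)
    have Neg: "Neg n \<sigma> \<subseteq> {1..n}" by (auto simp: Neg_def)
    show "(case (underlying \<sigma>, Neg n \<sigma> - {n}) of (\<pi>, M) \<Rightarrow> signed \<pi> (?N M)) = \<sigma>"
      using N'[OF Neg \<sigma>(2)] signed_underlying[OF \<sigma>(1)] by simp
    have "Neg n \<sigma> - {n} \<subseteq> {1..n - 1}"
      using Neg by force
    then show "(underlying \<sigma>, Neg n \<sigma> - {n}) \<in> ?P \<times> Pow {1..n - 1}"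
      using underlying_permutes[OF \<sigma>(1)] by simp
    show "(case (underlying \<sigma>, Neg n \<sigma> - {n}) of (\<pi>, M) \<Rightarrow> of_int (sign \<pi>) * f (signed \<pi> M))
        = (- 1) ^ length_D n \<sigma> * f (abs_last n \<sigma>)"
      using sign_length_D_signed[OF underlying_permutes[OF \<sigma>(1)] Neg, where 'a = 'a]
        abs_last_signed[OF underlying_permutes[OF \<sigma>(1)] n, of "Neg n \<sigma>"]
      by (simp add: signed_underlying[OF \<sigma>(1)])
  next
    fix p assume "p \<in> ?P \<times> Pow {1..n - 1}"
    then obtain \<pi> M where p: "p = (\<pi>, M)" "\<pi> permutes {1..n}" "M \<subseteq> {1..n - 1}"
      by auto
    show "(case p of (\<pi>, M) \<Rightarrow> signed \<pi> (?N M)) \<in> even_hyperoctahedral n"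
      using signed_in_hyperoctahedral[OF p(2) N(1)[OF p(3)]] N(2)[OF p(3)] Neg_signed[OF p(2) N(1)[OF p(3)]]
      by (simp add: p(1) even_hyperoctahedral_def neg_def del: if_split)
    show "(underlying (case p of (\<pi>, M) \<Rightarrow> signed \<pi> (?N M)),
           Neg n (case p of (\<pi>, M) \<Rightarrow> signed \<pi> (?N M)) - {n}) = p"
      using N(3)[OF p(3)] Neg_signed[OF p(2) N(1)[OF p(3)]]
      by (simp add: p(1) underlying_signed[OF p(2)] del: if_split)
  qed
  also have "\<dots> = (\<Sum>\<pi>\<in>?P. \<Sum>M\<in>Pow {1..n - 1}. of_int (sign \<pi>) * f (signed \<pi> M))"
    by (rule sum.cartesian_product[symmetric])
  finally show ?thesis by (simp only: sum_distrib_left)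
qed

section \<open>Summation over the signs\<close>

lemma sum_Pow_Un:
  fixes g h :: "'b set \<Rightarrow> 'a::comm_semiring_1"
  assumes "finite A" "finite B" "A \<inter> B = {}"
  shows "(\<Sum>N\<in>Pow (A \<union> B). g (N \<inter> A) * h (N \<inter> B)) = sum g (Pow A) * sum h (Pow B)"
proof -
  have parts: "(M \<union> L) \<inter> A = M" "(M \<union> L) \<inter> B = L" if "M \<subseteq> A" "L \<subseteq> B" for M L
    using that assms(3) by blast+
  have whole: "(N \<inter> A) \<union> (N \<inter> B) = N" if "N \<subseteq> A \<union> B" for N
    using that by blast
  have "(\<Sum>N\<in>Pow (A \<union> B). g (N \<inter> A) * h (N \<inter> B)) = (\<Sum>(M, L)\<in>Pow A \<times> Pow B. g M * h L)"
    by (rule sum.reindex_bij_witness[of _ "\<lambda>(M, L). M \<union> L" "\<lambda>N. (N \<inter> A, N \<inter> B)"])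
      (simp_all add: split_paired_all parts whole, blast)
  then show ?thesis
    by (simp add: sum_product sum.cartesian_product)
qed

text \<open>
  A weight that is a product over disjoint blocks can be summed block by block. This is the distributive law in the form
  needed for summing over sets of negative positions.
\<close>

lemma sum_Pow_UN:
  fixes f :: "'k \<Rightarrow> 'b set \<Rightarrow> 'a::comm_semiring_1"
  assumes "finite K" "\<And>k. k \<in> K \<Longrightarrow> finite (B k)"
    and "\<And>k l. k \<in> K \<Longrightarrow> l \<in> K \<Longrightarrow> k \<noteq> l \<Longrightarrow> B k \<inter> B l = {}"
  shows "(\<Sum>N\<in>Pow (\<Union>k\<in>K. B k). \<Prod>k\<in>K. f k (N \<inter> B k)) = (\<Prod>k\<in>K. sum (f k) (Pow (B k)))"
  using assms
proof (induction K rule: finite_induct)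
  case empty
  then show ?case by simp
next
  case (insert k K)
  let ?U = "\<Union>k\<in>K. B k"
  have IH: "(\<Sum>N\<in>Pow ?U. \<Prod>k\<in>K. f k (N \<inter> B k)) = (\<Prod>k\<in>K. sum (f k) (Pow (B k)))"
    by (rule insert.IH) (use insert.prems in auto)
  have "N \<inter> ?U \<inter> B l = N \<inter> B l" if "l \<in> K" for N l
    using that by blast
  then have "(\<Sum>N\<in>Pow (\<Union>k\<in>insert k K. B k). \<Prod>k\<in>insert k K. f k (N \<inter> B k))
      = (\<Sum>N\<in>Pow (B k \<union> ?U). f k (N \<inter> B k) * (\<Prod>k\<in>K. f k (N \<inter> ?U \<inter> B k)))"
    using insert.hyps by (intro sum.cong) auto
  also have "\<dots> = sum (f k) (Pow (B k)) * (\<Sum>N\<in>Pow ?U. \<Prod>k\<in>K. f k (N \<inter> B k))"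
    by (rule sum_Pow_Un) (use insert.hyps insert.prems in auto)
  finally show ?case
    using insert.hyps by (simp add: IH)
qed

text \<open>
  Here \<open>p\<close> and \<open>q\<close> are the absolute values of the entries at the adjacent positions \<open>a\<close>,
  \<open>b\<close>; the second sum is for a block whose second entry is kept positive.
\<close>

lemma sum_block:
  fixes X Y :: "'a::comm_ring_1" and p q :: int
  assumes "a \<noteq> b" "p > 0" "q > 0" "p \<noteq> q"
  shows "(\<Sum>M\<in>Pow {a, b}. (if (if b \<in> M then - q else q) < (if a \<in> M then - p else p) then Y else 1)
              * (if a \<in> M then X else 1))
         = (if p < q then (1 + X) * (1 + Y) else 2 * X + 2 * Y)" (is "sum ?w _ = _")
    and "(\<Sum>M\<in>Pow {a}. (if (if b \<in> M then - q else q) < (if a \<in> M then - p else p) then Y else 1)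
              * (if a \<in> M then X else 1))
         = (if p < q then 1 + X else X + Y)"
proof -
  have "{b} \<noteq> {a}" "{b} \<noteq> {a, b}" "{a, b} \<noteq> {a}"
    using assms by auto
  then show "sum ?w (Pow {a, b}) = (if p < q then (1 + X) * (1 + Y) else 2 * X + 2 * Y)"
    using assms by (simp add: Pow_insert algebra_simps)
  show "sum ?w (Pow {a}) = (if p < q then 1 + X else X + Y)"
    using assms by (simp add: Pow_insert algebra_simps)
qed

text \<open>
  The common shape of both weights. Blocks are indexed from 0. For \<open>c = 0\<close> they start at odd positions; for
  \<open>c = 1\<close> they start at even positions, and the factor \<open>t\<close> accounts for the sign at position 1.
\<close>

definition block_weight ::
    "'a::comm_ring_1 \<Rightarrow> (nat \<Rightarrow> 'a) \<Rightarrow> 'a \<Rightarrow> nat \<Rightarrow> nat \<Rightarrow> (nat \<Rightarrow> nat) \<Rightarrow> nat set \<Rightarrow> 'a" where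
  "block_weight X Y t c K \<pi> N = (if c = 1 \<and> 1 \<in> N then t else 1) *
     (\<Prod>k<K. (if signed \<pi> N (int (2 * k + c + 2)) < signed \<pi> N (int (2 * k + c + 1)) then Y k else 1)
            * (if 2 * k + c + 1 \<in> N then X else 1))"

text \<open>
  The set \<open>{1..n - 1}\<close> splits into the \<open>c\<close> initial positions and the blocks, where \<open>n\<close> is removed
  from the last block if it ends there.
\<close>

lemma sum_block_weight:
  fixes X t :: "'a::comm_ring_1" and Y :: "nat \<Rightarrow> 'a"
  assumes \<pi>: "\<pi> permutes {1..n}" and n: "n \<ge> 2" and c: "c \<le> 1" and K: "K = (n - c) div 2"
  shows "(\<Sum>N\<in>Pow {1..n - 1}. block_weight X Y t c K \<pi> N)
       = (if c = 1 then 1 + t else 1) *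
         (\<Prod>k<K. if \<pi> (2 * k + c + 1) < \<pi> (2 * k + c + 2)
            then (if 2 * k + c + 2 = n then 1 + X else (1 + X) * (1 + Y k))
            else (if 2 * k + c + 2 = n then X + Y k else 2 * X + 2 * Y k))"
proof -
  define B where "B k = {2 * k + c + 1, 2 * k + c + 2} - {n}" for k
  define p where "p = (\<lambda>M :: nat set. if c = 1 \<and> 1 \<in> M then t else 1)"
  define f where "f k M =
      (if (if 2 * k + c + 2 \<in> M then - int (\<pi> (2 * k + c + 2)) else int (\<pi> (2 * k + c + 2)))
         < (if 2 * k + c + 1 \<in> M then - int (\<pi> (2 * k + c + 1)) else int (\<pi> (2 * k + c + 1)))
       then Y k else 1) * (if 2 * k + c + 1 \<in> M then X else 1)" for k and M :: "nat set"
  let ?U = "\<Union>k<K. B k"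
  have cover: "{1..n - 1} = {1..c} \<union> ?U"
  proof (intro equalityI subsetI)
    fix i assume i: "i \<in> {1..n - 1}"
    show "i \<in> {1..c} \<union> ?U"
    proof (cases "i \<le> c")
      case False
      define k where "k = (i - c - 1) div 2"
      have "k < K" "i = 2 * k + c + 1 \<or> i = 2 * k + c + 2"
        using i False unfolding k_def K by auto
      then show ?thesis using i by (auto simp: B_def)
    qed (use i in auto)
  qed (use n c K in \<open>auto simp: B_def\<close>)
  have disj: "{1..c} \<inter> ?U = {}" by (auto simp: B_def)
  have disjB: "B k \<inter> B l = {}" if "k \<noteq> l" for k l
    using that by (auto simp: B_def; presburger)
  have first_lt: "2 * k + c + 1 \<in> B k" if "k < K" for k
    using that K by (auto simp: B_def)
  have weight: "block_weight X Y t c K \<pi> N = p (N \<inter> {1..c}) * (\<Prod>k<K. f k (N \<inter> ?U \<inter> B k))"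
    if N: "N \<subseteq> {1..n - 1}" for N
  proof -
    have "f k (N \<inter> ?U \<inter> B k) = (if signed \<pi> N (int (2 * k + c + 2)) < signed \<pi> N (int (2 * k + c + 1))
        then Y k else 1) * (if 2 * k + c + 1 \<in> N then X else 1)" if k: "k < K" for k
    proof -
      have "2 * k + c + 1 \<in> N \<inter> ?U \<inter> B k \<longleftrightarrow> 2 * k + c + 1 \<in> N"
        using first_lt[OF k] k by blast
      moreover have "2 * k + c + 2 \<in> N \<inter> ?U \<inter> B k \<longleftrightarrow> 2 * k + c + 2 \<in> N"
        using k N n by (auto simp: B_def)
      ultimately show ?thesis
        unfolding f_def signed_of_nat[OF \<pi>] by simp
    qed
    moreover have "p (N \<inter> {1..c}) = (if c = 1 \<and> 1 \<in> N then t else 1)"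
      by (auto simp: p_def)
    ultimately show ?thesis
      unfolding block_weight_def by simp
  qed
  have block: "sum (f k) (Pow (B k)) =
      (if \<pi> (2 * k + c + 1) < \<pi> (2 * k + c + 2)
       then (if 2 * k + c + 2 = n then 1 + X else (1 + X) * (1 + Y k))
       else (if 2 * k + c + 2 = n then X + Y k else 2 * X + 2 * Y k))" if k: "k < K" for k
  proof -
    have d: "2 * k + c + 1 \<noteq> 2 * k + c + 2" by simp
    have pos: "int (\<pi> (2 * k + c + 1)) > 0" "int (\<pi> (2 * k + c + 2)) > 0"
      using permutes_pos_iff[OF \<pi>] by simp_all
    have ne: "int (\<pi> (2 * k + c + 1)) \<noteq> int (\<pi> (2 * k + c + 2))"
      using inj_eq[OF permutes_inj[OF \<pi>]] by simp
    have "2 * k + c + 1 \<noteq> n" using k K by auto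
    show ?thesis
    proof (cases "2 * k + c + 2 = n")
      case True
      have "B k = {2 * k + c + 1}"
        using True by (auto simp: B_def)
      then have "sum (f k) (Pow (B k)) =
          (if \<pi> (2 * k + c + 1) < \<pi> (2 * k + c + 2) then 1 + X else X + Y k)"
        using sum_block(2)[OF d pos ne, of "Y k" X] unfolding f_def by (simp only: of_nat_less_iff)
      then show ?thesis
        by (simp only: True simp_thms if_True)
    next
      case False
      then have "B k = {2 * k + c + 1, 2 * k + c + 2}"
        using \<open>2 * k + c + 1 \<noteq> n\<close> by (auto simp: B_def)
      then have "sum (f k) (Pow (B k)) =
          (if \<pi> (2 * k + c + 1) < \<pi> (2 * k + c + 2) then (1 + X) * (1 + Y k) else 2 * X + 2 * Y k)"
        using sum_block(1)[OF d pos ne, of "Y k" X] unfolding f_def by (simp only: of_nat_less_iff)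
      then show ?thesis
        by (simp only: False if_False)
    qed
  qed
  have "sum p (Pow {1..c}) = (if c = 1 then 1 + t else 1)"
    using c by (cases "c = 0") (auto simp: p_def le_Suc_eq Pow_insert)
  moreover have "(\<Sum>N\<in>Pow ?U. \<Prod>k<K. f k (N \<inter> B k)) = (\<Prod>k<K. sum (f k) (Pow (B k)))"
    by (rule sum_Pow_UN) (use disjB in \<open>auto simp: B_def\<close>)
  moreover have "(\<Sum>N\<in>Pow {1..n - 1}. block_weight X Y t c K \<pi> N)
      = (\<Sum>N\<in>Pow ({1..c} \<union> ?U). p (N \<inter> {1..c}) * (\<Prod>k<K. f k (N \<inter> ?U \<inter> B k)))"
    by (rule sum.cong) (use weight cover in auto)
  moreover have "\<dots> = sum p (Pow {1..c}) * (\<Sum>N\<in>Pow ?U. \<Prod>k<K. f k (N \<inter> B k))"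
    by (rule sum_Pow_Un) (use disj in \<open>auto simp: B_def\<close>)
  ultimately show ?thesis
    using block by simp
qed

text \<open>
  The block that ends at \<open>n\<close>, which exists iff \<open>n - c\<close> is even, lacks the factor \<open>1 - X\<close>.
\<close>

lemma prod_block_factors:
  fixes X :: "'a::comm_ring_1"
  assumes n: "n \<ge> 2" and c: "c \<le> 1" and K: "K = (n - c) div 2"
  shows "(\<Prod>k<K. if 2 * k + c + 2 = n then 1 else 1 - X) = (1 - X) ^ ((n - 1 - c) div 2)"
proof -
  have "(\<Prod>k<K. if 2 * k + c + 2 = n then 1 else 1 - X) = (\<Prod>k<(n - 1 - c) div 2. 1 - X)"
    by (rule prod.mono_neutral_cong_right) (use n c K in auto)
  then show ?thesis by simp
qed

definition sign_count :: "nat \<Rightarrow> nat \<Rightarrow> int" where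
  "sign_count n c = sum sign (pairwise_increasing n c ((n - c) div 2))"

lemma prod_of_bool:
  fixes K :: nat
  shows "(\<Prod>k<K. of_bool (P k)) = (of_bool (\<forall>k<K. P k) :: 'a::comm_semiring_1)"
  by (induction K) (auto simp: less_Suc_eq)

lemma sum_sign_block_weight:
  fixes X t :: "'a::comm_ring_1" and Y :: "nat \<Rightarrow> 'a"
  assumes n: "n \<ge> 2" and c: "c \<le> 1" and K: "K = (n - c) div 2"
  shows "(\<Sum>\<pi> | \<pi> permutes {1..n}. of_int (sign \<pi>) *
            (\<Sum>N\<in>Pow {1..n - 1}. block_weight X Y t c K \<pi> N))
       = of_int (sign_count n c) * (if c = 1 then 1 + t else 1) * (1 - X) ^ ((n - 1 - c) div 2)
         * (\<Prod>k<K. 1 - Y k)"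
proof -
  let ?P = "{\<pi>. \<pi> permutes {1..n}}"
  let ?a = "\<lambda>k. 2 * k + c + 1" and ?b = "\<lambda>k. 2 * k + c + 2"
  let ?A = "\<lambda>k. if ?b k = n then 1 + X else (1 + X) * (1 + Y k)"
  let ?B = "\<lambda>k. if ?b k = n then X + Y k else 2 * X + 2 * Y k"
  let ?T = "if c = 1 then 1 + t else 1"
  have fin: "finite ?P" by (simp add: finite_permutations)
  have "(\<Sum>\<pi>\<in>?P. of_int (sign \<pi>) * (\<Sum>N\<in>Pow {1..n - 1}. block_weight X Y t c K \<pi> N))
      = (\<Sum>\<pi>\<in>?P. of_int (sign \<pi>) * (?T * (\<Prod>k<K. if \<pi> (?a k) < \<pi> (?b k) then ?A k else ?B k)))"
    by (rule sum.cong[OF refl]) (simp only: mem_Collect_eq sum_block_weight[OF _ n c K])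
  also have "\<dots> = (\<Prod>k<K. ?A k - ?B k) *
      (\<Sum>\<pi>\<in>?P. of_int (sign \<pi>) * (?T * (\<Prod>k<K. of_bool (\<pi> (?a k) < \<pi> (?b k)))))"
    by (rule sum_sign_antisymmetrize) (use n c K in \<open>auto simp: Suc_double_not_eq_double double_not_eq_Suc_double\<close>)
  also have "(\<Prod>k<K. ?A k - ?B k) = (\<Prod>k<K. (if ?b k = n then 1 else 1 - X) * (1 - Y k))"
    by (rule prod.cong) (auto simp: algebra_simps)
  also have "\<dots> = (1 - X) ^ ((n - 1 - c) div 2) * (\<Prod>k<K. 1 - Y k)"
    by (simp only: prod.distrib prod_block_factors[OF n c K])
  also have "(\<Sum>\<pi>\<in>?P. of_int (sign \<pi>) * (?T * (\<Prod>k<K. of_bool (\<pi> (?a k) < \<pi> (?b k)))))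
      = (\<Sum>\<pi>\<in>?P. if \<forall>k<K. \<pi> (?a k) < \<pi> (?b k) then ?T * of_int (sign \<pi>) else 0)"
    by (rule sum.cong) (auto simp: prod_of_bool)
  also have "\<dots> = (\<Sum>\<pi>\<in>pairwise_increasing n c K. ?T * of_int (sign \<pi>))"
    using fin by (simp add: sum.inter_filter[symmetric] pairwise_increasing_def)
  also have "\<dots> = ?T * of_int (sign_count n c)"
    by (simp add: sign_count_def K of_int_sum sum_distrib_left)
  finally show ?thesis by (simp only: mult_ac)
qed

lemma sign_count_odd_positions: "sign_count n 0 = fact (n div 2)"
proof (cases "even n")
  case True
  then show ?thesis
    using sum_sign_pairwise_increasing[of 0 "n div 2"] by (simp add: sign_count_def)
next
  case False
  then have "2 * (n div 2) + 1 = n" by presburger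
  then show ?thesis
    using sum_sign_pairwise_increasing_last_free[of "n div 2"] by (simp add: sign_count_def)
qed

text \<open>
  For even \<open>n\<close> the positions \<open>1\<close> and \<open>n\<close> both lie outside the blocks, and exchanging them
  reverses the sign.
\<close>

lemma sign_count_even_positions:
  assumes n: "n \<ge> 2"
  shows "sign_count n 1 = (if odd n then fact (n div 2) else 0)"
proof (cases "odd n")
  case True
  then have "2 * (n div 2) + 1 = n" "(n - 1) div 2 = n div 2" by presburger+
  then show ?thesis
    using sum_sign_pairwise_increasing[of 1 "n div 2"] True by (simp add: sign_count_def)
next
  case False
  let ?K = "(n - 1) div 2"
  let ?R = "\<lambda>\<pi> :: nat \<Rightarrow> nat. of_bool (\<forall>k<?K. \<pi> (2 * k + 1 + 1) < \<pi> (2 * k + 1 + 2)) :: int"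
  have "(\<Sum>\<pi> | \<pi> permutes {1..n}. of_int (sign \<pi>) * ?R \<pi>) = 0"
  proof (rule sum_sign_swap_invariant[of _ 1 n])
    fix \<pi> :: "nat \<Rightarrow> nat"
    have "transpose 1 n (2 * k + 1 + 1) = 2 * k + 1 + 1" "transpose 1 n (2 * k + 1 + 2) = 2 * k + 1 + 2"
      if "k < ?K" for k
      using that False by (auto simp: transpose_def)
    then show "?R (\<pi> \<circ> transpose 1 n) = ?R \<pi>" by simp
  qed (use n in auto)
  moreover have "(\<Sum>\<pi> | \<pi> permutes {1..n}. of_int (sign \<pi>) * ?R \<pi>) = sign_count n 1"
    unfolding sign_count_def pairwise_increasing_def
    by (rule sum.mono_neutral_cong_right) (auto simp: finite_permutations)
  ultimately show ?thesis using False by simp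
qed

section \<open>The weights\<close>

lemma weight_eq_prod:
  fixes x y z :: "'a::comm_ring_1"
  assumes "finite A"
  shows "x ^ (2 * sum h A + card B) * y ^ card A * z ^ card B
       = (\<Prod>i\<in>A. y * x ^ (2 * h i)) * (\<Prod>i\<in>B. x * z)"
  by (simp add: prod.distrib power_sum power_add power_mult power_mult_distrib mult_ac
        flip: sum_distrib_left prod_power_distrib)

lemma prod_image_filter:
  fixes f :: "'b \<Rightarrow> 'a::comm_monoid_mult" and K :: nat
  assumes "inj_on g {..<K}"
  shows "prod f (g ` {k. k < K \<and> P k}) = (\<Prod>k<K. if P k then f (g k) else 1)"
proof -
  have "prod f (g ` {k. k < K \<and> P k}) = (\<Prod>k | k \<in> {..<K} \<and> P k. f (g k))"
    using assms by (subst prod.reindex) (auto elim: inj_on_subset)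
  then show ?thesis by (simp only: prod.inter_filter[OF finite_lessThan])
qed

lemma odd_part_eq_image:
  assumes "A \<subseteq> {..<n}"
  shows "odd_part A = (\<lambda>k. 2 * k + 1) ` {k. k < n div 2 \<and> 2 * k + 1 \<in> A}"
proof (intro equalityI subsetI)
  fix i assume i: "i \<in> odd_part A"
  then obtain k where "i = 2 * k + 1"
    by (auto simp: odd_part_def elim: oddE)
  moreover have "i < n" using i assms by (auto simp: odd_part_def)
  ultimately show "i \<in> (\<lambda>k. 2 * k + 1) ` {k. k < n div 2 \<and> 2 * k + 1 \<in> A}"
    using i by (intro image_eqI[of _ _ k]) (auto simp: odd_part_def)
qed (auto simp: odd_part_def)

lemma even_part_eq_image:
  assumes "A \<subseteq> {..<n}"
  shows "even_part A = (if 0 \<in> A then {0} else {}) \<union>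
           (\<lambda>k. 2 * k + 2) ` {k. k < (n - 1) div 2 \<and> 2 * k + 2 \<in> A}" (is "_ = ?Z \<union> ?I")
proof (intro equalityI subsetI)
  fix i assume i: "i \<in> even_part A"
  show "i \<in> ?Z \<union> ?I"
  proof (cases "i = 0")
    case False
    define k where "k = i div 2 - 1"
    have "i = 2 * k + 2"
      using i False by (auto simp: k_def even_part_def elim!: evenE)
    moreover have "i < n" using i assms by (auto simp: even_part_def)
    ultimately have "i \<in> ?I"
      using i by (intro image_eqI[of _ _ k]) (auto simp: even_part_def)
    then show ?thesis by blast
  qed (use i in \<open>simp add: even_part_def\<close>)
qed (auto simp: even_part_def split: if_splits)

lemma odd_weight:
  fixes x y z :: "'a::comm_ring_1"
  assumes \<pi>: "\<pi> permutes {1..n}" and N: "N \<subseteq> {1..n - 1}"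
  shows "x ^ ofmaj n (signed \<pi> N) * y ^ odes n (signed \<pi> N) * z ^ oneg n (signed \<pi> N)
       = block_weight (x * z) (\<lambda>k. y * x ^ (2 * Suc k)) y 0 (n div 2) \<pi> N"
proof -
  let ?\<tau> = "signed \<pi> N" and ?K = "n div 2"
  let ?g = "\<lambda>k. 2 * k + 1 :: nat"
  have sub: "descents n ?\<tau> \<subseteq> {..<n}" "N \<subseteq> {..<n}"
    using N by (force simp: descents_def)+
  \<comment> \<open>The summand 0 is the offset \<open>c\<close> of the blocks, kept visible so that the terms match
    \<open>block_weight\<close>.\<close>
  have "{k. k < ?K \<and> ?g k \<in> descents n ?\<tau>}
      = {k. k < ?K \<and> ?\<tau> (int (2 * k + 0 + 2)) < ?\<tau> (int (2 * k + 0 + 1))}"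
    by (rule Collect_cong) (auto simp: descents_def)
  then have des: "odd_part (descents n ?\<tau>)
      = ?g ` {k. k < ?K \<and> ?\<tau> (int (2 * k + 0 + 2)) < ?\<tau> (int (2 * k + 0 + 1))}"
    using odd_part_eq_image[OF sub(1)] by simp
  have "Neg n ?\<tau> = N"
    using N by (intro Neg_signed[OF \<pi>]) force
  then have neg: "odd_part (Neg n ?\<tau>) = ?g ` {k. k < ?K \<and> 2 * k + 0 + 1 \<in> N}"
    using odd_part_eq_image[OF sub(2)] by simp
  have inj: "inj_on ?g {..<?K}" by (auto simp: inj_on_def)
  have fin: "finite (odd_part (descents n ?\<tau>))"
    using finite_subset[OF sub(1)] by (simp add: odd_part_def)
  show ?thesis
    unfolding ofmaj_def omaj_def odes_def oneg_def block_weight_def weight_eq_prod[OF fin]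
    unfolding des neg prod_image_filter[OF inj] prod.distrib[symmetric]
    by (auto intro!: prod.cong)
qed

text \<open>
  The additional factor \<open>y\<close> comes from the descent at 0: it is present iff the first entry is negative, and it does
  not contribute to the major index.
\<close>

lemma even_weight:
  fixes x y z :: "'a::comm_ring_1"
  assumes \<pi>: "\<pi> permutes {1..n}" and N: "N \<subseteq> {1..n - 1}" and n: "n \<ge> 1"
  shows "x ^ efmaj n (signed \<pi> N) * y ^ edes n (signed \<pi> N) * z ^ eneg n (signed \<pi> N)
       = block_weight (x * z) (\<lambda>k. y * x ^ (2 * Suc k)) y 1 ((n - 1) div 2) \<pi> N"
proof -
  let ?\<tau> = "signed \<pi> N" and ?K = "(n - 1) div 2"
  let ?g = "\<lambda>k. 2 * k + 2 :: nat"
  let ?Z = "if 1 \<in> N then {0} else {} :: nat set"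
  let ?D = "?g ` {k. k < ?K \<and> ?\<tau> (int (2 * k + 1 + 2)) < ?\<tau> (int (2 * k + 1 + 1))}"
  have sub: "descents n ?\<tau> \<subseteq> {..<n}" "N \<subseteq> {..<n}"
    using N by (force simp: descents_def)+
  have "?\<tau> (int (0 + 1)) < ?\<tau> (int 0) \<longleftrightarrow> 1 \<in> N"
    using permutes_pos_iff[OF \<pi>, of 0] permutes_pos_iff[OF \<pi>, of 1] unfolding signed_of_nat[OF \<pi>] by simp
  then have zero: "0 \<in> descents n ?\<tau> \<longleftrightarrow> 1 \<in> N"
    using n unfolding descents_def by simp
  have "{k. k < ?K \<and> ?g k \<in> descents n ?\<tau>}
      = {k. k < ?K \<and> ?\<tau> (int (2 * k + 1 + 2)) < ?\<tau> (int (2 * k + 1 + 1))}"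
    by (rule Collect_cong) (auto simp: descents_def)
  then have des: "even_part (descents n ?\<tau>) = ?Z \<union> ?D"
    using even_part_eq_image[OF sub(1)] zero by simp
  have "Neg n ?\<tau> = N"
    using N by (intro Neg_signed[OF \<pi>]) force
  moreover have "0 \<notin> N" using N by auto
  ultimately have neg: "even_part (Neg n ?\<tau>) = ?g ` {k. k < ?K \<and> 2 * k + 1 + 1 \<in> N}"
    using even_part_eq_image[OF sub(2)] by simp
  have inj: "inj_on ?g {..<?K}" by (auto simp: inj_on_def)
  have fin: "finite (even_part (descents n ?\<tau>))"
    using finite_subset[OF sub(1)] by (simp add: even_part_def)
  have split: "(\<Prod>i\<in>?Z \<union> ?D. y * x ^ (2 * (i div 2)))
      = (if 1 \<in> N then y else 1) * (\<Prod>i\<in>?D. y * x ^ (2 * (i div 2)))"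
    by (subst prod.union_disjoint) auto
  show ?thesis
    unfolding efmaj_def emaj_def edes_def eneg_def block_weight_def weight_eq_prod[OF fin]
    unfolding des neg split prod_image_filter[OF inj] mult.assoc prod.distrib[symmetric]
    by (auto intro!: prod.cong arg_cong2[where f = "(*)"])
qed

theorem corollary4p11:
  fixes n :: nat and x y z :: "'a::comm_ring_1"
  assumes "n \<ge> 2"
  shows "(\<Sum>\<sigma>\<in>even_hyperoctahedral n.
            (- 1) ^ length_D n \<sigma> * x ^ oDmaj n \<sigma> * y ^ odes_D n \<sigma> * z ^ oneg_D n \<sigma>)
         = of_nat (fact (n div 2)) * (1 - x * z) ^ ((n - 1) div 2)
           * (\<Prod>i = 1..n div 2. 1 - y * x ^ (2 * i))
       \<and> (\<Sum>\<sigma>\<in>even_hyperoctahedral n.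
            (- 1) ^ length_D n \<sigma> * x ^ eDmaj n \<sigma> * y ^ edes_D n \<sigma> * z ^ eneg_D n \<sigma>)
         = of_int (parity_ind (int n + 1)) * of_nat (fact (n div 2)) * (1 + y)
           * (1 - x * z) ^ ((n - 2) div 2)
           * (\<Prod>i = 1..n div 2. 1 - y * x ^ (2 * i))"
proof
  let ?P = "{\<pi>. \<pi> permutes {1..n}}"
  let ?Y = "\<lambda>k. y * x ^ (2 * Suc k)"
  have n: "n \<ge> 1" using assms by simp
  have shift: "(\<Prod>i = 1..m. 1 - y * x ^ (2 * i)) = (\<Prod>k<m. 1 - ?Y k)" for m
    using prod.atLeast1_atMost_eq[of "\<lambda>i. 1 - y * x ^ (2 * i)" m] by simp
  have of_int_fact: "of_int (fact m) = (of_nat (fact m) :: 'a)" for m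
    by (metis of_int_of_nat_eq of_nat_fact)
  have "(\<Sum>\<sigma>\<in>even_hyperoctahedral n.
            (- 1) ^ length_D n \<sigma> * x ^ oDmaj n \<sigma> * y ^ odes_D n \<sigma> * z ^ oneg_D n \<sigma>)
      = (\<Sum>\<pi>\<in>?P. of_int (sign \<pi>) * (\<Sum>N\<in>Pow {1..n - 1}.
            x ^ ofmaj n (signed \<pi> N) * y ^ odes n (signed \<pi> N) * z ^ oneg n (signed \<pi> N)))"
    unfolding oDmaj_def odes_D_def oneg_D_def
    using sum_even_hyperoctahedral[OF n, of "\<lambda>\<tau>. x ^ ofmaj n \<tau> * y ^ odes n \<tau> * z ^ oneg n \<tau>"]
    by (simp only: mult.assoc)
  also have "\<dots> = (\<Sum>\<pi>\<in>?P. of_int (sign \<pi>) * (\<Sum>N\<in>Pow {1..n - 1}.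
            block_weight (x * z) ?Y y 0 (n div 2) \<pi> N))"
    by (intro sum.cong refl arg_cong2[where f = "(*)"] odd_weight) auto
  also have "\<dots> = of_nat (fact (n div 2)) * (1 - x * z) ^ ((n - 1) div 2) * (\<Prod>k<n div 2. 1 - ?Y k)"
    using sum_sign_block_weight[of n 0 "n div 2" "x * z" ?Y y] assms
    by (simp add: sign_count_odd_positions of_int_fact)
  finally show "(\<Sum>\<sigma>\<in>even_hyperoctahedral n.
            (- 1) ^ length_D n \<sigma> * x ^ oDmaj n \<sigma> * y ^ odes_D n \<sigma> * z ^ oneg_D n \<sigma>)
         = of_nat (fact (n div 2)) * (1 - x * z) ^ ((n - 1) div 2)
           * (\<Prod>i = 1..n div 2. 1 - y * x ^ (2 * i))"
    by (simp only: shift)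
  have "(\<Sum>\<sigma>\<in>even_hyperoctahedral n.
            (- 1) ^ length_D n \<sigma> * x ^ eDmaj n \<sigma> * y ^ edes_D n \<sigma> * z ^ eneg_D n \<sigma>)
      = (\<Sum>\<pi>\<in>?P. of_int (sign \<pi>) * (\<Sum>N\<in>Pow {1..n - 1}.
            x ^ efmaj n (signed \<pi> N) * y ^ edes n (signed \<pi> N) * z ^ eneg n (signed \<pi> N)))"
    unfolding eDmaj_def edes_D_def eneg_D_def
    using sum_even_hyperoctahedral[OF n, of "\<lambda>\<tau>. x ^ efmaj n \<tau> * y ^ edes n \<tau> * z ^ eneg n \<tau>"]
    by (simp only: mult.assoc)
  also have "\<dots> = (\<Sum>\<pi>\<in>?P. of_int (sign \<pi>) * (\<Sum>N\<in>Pow {1..n - 1}.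
            block_weight (x * z) ?Y y 1 ((n - 1) div 2) \<pi> N))"
    by (intro sum.cong refl arg_cong2[where f = "(*)"] even_weight) (use n in auto)
  also have "\<dots> = of_int (sign_count n 1) * (1 + y) * (1 - x * z) ^ ((n - 2) div 2)
                  * (\<Prod>k<(n - 1) div 2. 1 - ?Y k)"
    using sum_sign_block_weight[of n 1 "(n - 1) div 2" "x * z" ?Y y] assms
    by (simp add: numeral_2_eq_2)
  also have "\<dots> = of_int (parity_ind (int n + 1)) * of_nat (fact (n div 2)) * (1 + y)
           * (1 - x * z) ^ ((n - 2) div 2) * (\<Prod>k<n div 2. 1 - ?Y k)"
  proof (cases "odd n")
    case True
    have "nat \<bar>int n + 1\<bar> = Suc n" by simp
    then have "parity_ind (int n + 1) = 1"
      using True by (simp add: parity_ind_def)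
    moreover have "(n - 1) div 2 = n div 2" using True by presburger
    ultimately show ?thesis
      unfolding sign_count_even_positions[OF assms] using True by (simp add: of_int_fact)
  next
    case False
    have "nat \<bar>int n + 1\<bar> = Suc n" by simp
    then have "parity_ind (int n + 1) = 0"
      using False by (simp add: parity_ind_def)
    then show ?thesis
      unfolding sign_count_even_positions[OF assms] using False by simp
  qed
  finally show "(\<Sum>\<sigma>\<in>even_hyperoctahedral n.
            (- 1) ^ length_D n \<sigma> * x ^ eDmaj n \<sigma> * y ^ edes_D n \<sigma> * z ^ eneg_D n \<sigma>)
         = of_int (parity_ind (int n + 1)) * of_nat (fact (n div 2)) * (1 + y)
           * (1 - x * z) ^ ((n - 2) div 2)
           * (\<Prod>i = 1..n div 2. 1 - y * x ^ (2 * i))"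
    by (simp only: shift)
qed

end
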